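(* Let $\mathbb{L}=(\mathcal{L},\Omega,\models)$ be a logic and let $\circ$ be a base change operator for $\mathbb{L}$. Then $\circ$ satisfies the postulates (G1)--(G6) if and only if there exists a min-friendly faithful assignment $\preceq_{(\cdot)}$ for $\mathbb{L}$ such that $\circ$ is compatible with $\preceq_{(\cdot)}$.
   Context: A logic is a triple $\mathbb{L}=(\mathcal{L},\Omega,\models)$, where $\mathcal{L}$ is a (possibly infinite) set of sentences, $\Omega$ is a (possibly infinite) class of interpretations, and $\models$ is an arbitrary binary relation between $\Omega$ and $\mathcal{L}$. No further requirements are imposed. A belief base is a finite subset of $\mathcal{L}$; $\mathcal{P}_{\mathrm{fin}}(\mathcal{L})$ is the set of belief bases. For $\varphi\in\mathcal{L}$, $[\![\varphi]\!]=\{\omega\in\Omega\mid\omega\models\varphi\}$; for a belief base $\mathcal{K}$, $[\![\mathcal{K}]\!]=\bigcap_{\varphi\in\mathcal{K}}[\![\varphi]\!]$ (so $[\![\emptyset]\!]=\Omega$), and $\omega\models\mathcal{K}$ means $\omega\in[\![\mathcal{K}]\!]$. For belief bases, $\mathcal{K}\models\mathcal{K}'$ means $[\![\mathcal{K}]\!]\subseteq[\![\mathcal{K}']\!]$, and $\mathcal{K}\equiv\mathcal{K}'$ means $[\![\mathcal{K}]\!]=[\![\mathcal{K}']\!]$. A base change operator for $\mathbb{L}$ is a function $\circ:\mathcal{P}_{\mathrm{fin}}(\mathcal{L})\times\mathcal{P}_{\mathrm{fin}}(\mathcal{L})\to\mathcal{P}_{\mathrm{fin}}(\mathcal{L})$.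 Postulates (for all belief bases $\mathcal{K},\mathcal{K}_1,\mathcal{K}_2,\Gamma,\Gamma_1,\Gamma_2$): (G1) $\mathcal{K}\circ\Gamma\models\Gamma$. (G2) If $[\![\mathcal{K}\cup\Gamma]\!]\neq\emptyset$ then $\mathcal{K}\circ\Gamma\equiv\mathcal{K}\cup\Gamma$. (G3) If $[\![\Gamma]\!]\neq\emptyset$ then $[\![\mathcal{K}\circ\Gamma]\!]\neq\emptyset$. (G4) If $\mathcal{K}_1\equiv\mathcal{K}_2$ and $\Gamma_1\equiv\Gamma_2$ then $\mathcal{K}_1\circ\Gamma_1\equiv\mathcal{K}_2\circ\Gamma_2$. (G5) $(\mathcal{K}\circ\Gamma_1)\cup\Gamma_2\models\mathcal{K}\circ(\Gamma_1\cup\Gamma_2)$. (G6) If $[\![(\mathcal{K}\circ\Gamma_1)\cup\Gamma_2]\!]\neq\emptyset$ then $\mathcal{K}\circ(\Gamma_1\cup\Gamma_2)\models(\mathcal{K}\circ\Gamma_1)\cup\Gamma_2$. For a binary relation $\preceq$ over $\Omega$: $\preceq$ is total if for all $\omega_1,\omega_2\in\Omega$, $\omega_1\preceq\omega_2$ or $\omega_2\preceq\omega_1$; $\omega_1\prec\omega_2$ means $\omega_1\preceq\omega_2$ and $\omega_2\not\preceq\omega_1$; for $\Omega'\subseteq\Omega$, $\min(\Omega',\preceq)=\{\omega\in\Omega'\mid\omega\preceq\omega'\text{ for all }\omega'\in\Omega'\}$. The relation $\preceq$ is min-retractive if for every belief base $\Gamma$ and all $\omega,\omega'\in[\![\Gamma]\!]$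 with $\omega'\preceq\omega$ and $\omega\in\min([\![\Gamma]\!],\preceq)$ it holds that $\omega'\in\min([\![\Gamma]\!],\preceq)$; it is min-complete if $\min([\![\Gamma]\!],\preceq)\neq\emptyset$ for every belief base $\Gamma$ with $[\![\Gamma]\!]\neq\emptyset$; it is min-friendly if it is both min-retractive and min-complete. An assignment is a function $\preceq_{(\cdot)}$ assigning to each belief base $\mathcal{K}$ a total binary relation $\preceq_{\mathcal{K}}$ over $\Omega$. It is min-friendly if every $\preceq_{\mathcal{K}}$ is min-friendly. It is faithful if for all belief bases $\mathcal{K},\mathcal{K}'$ and all $\omega,\omega'\in\Omega$: (F1) if $\omega,\omega'\models\mathcal{K}$, then $\omega\prec_{\mathcal{K}}\omega'$ does not hold; (F2) if $\omega\models\mathcal{K}$ and $\omega'\not\models\mathcal{K}$, then $\omega\prec_{\mathcal{K}}\omega'$; (F3) if $\mathcal{K}\equiv\mathcal{K}'$, then ${\preceq_{\mathcal{K}}}={\preceq_{\mathcal{K}'}}$. A base change operator $\circ$ is compatible with $\preceq_{(\cdot)}$ if $[\![\mathcal{K}\circ\Gamma]\!]=\min([\![\Gamma]\!],\preceq_{\mathcal{K}})$ for all belief bases $\mathcal{K},\Gamma$. *)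

theory Defs
  imports Main
begin

(* Sentences and interpretations are carrier sets, so that both may be empty.
   The satisfaction predicate is unconstrained; its values outside
   Interps \<times> Sentences are never inspected by the notions below when these
   are applied to belief bases. *)
record ('s, 'w) base_logic =
  Sentences :: "'s set"
  Interps :: "'w set"
  Sat :: "'w \<Rightarrow> 's \<Rightarrow> bool"

definition belief_base :: "('s, 'w) base_logic \<Rightarrow> 's set \<Rightarrow> bool" where
  "belief_base LL K \<longleftrightarrow> finite K \<and> K \<subseteq> Sentences LL"

definition sentence_models :: "('s, 'w) base_logic \<Rightarrow> 's \<Rightarrow> 'w set" where
  "sentence_models LL \<phi> = {\<omega> \<in> Interps LL. Sat LL \<omega> \<phi>}"

(* Intersecting with Interps LL only matters for K = {}. *)
definition models :: "('s, 'w) base_logic \<Rightarrow> 's set \<Rightarrow> 'w set" where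
  "models LL K = Interps LL \<inter> (\<Inter>\<phi>\<in>K. sentence_models LL \<phi>)"

definition entails :: "('s, 'w) base_logic \<Rightarrow> 's set \<Rightarrow> 's set \<Rightarrow> bool" where
  "entails LL K K' \<longleftrightarrow> models LL K \<subseteq> models LL K'"

definition equivalent :: "('s, 'w) base_logic \<Rightarrow> 's set \<Rightarrow> 's set \<Rightarrow> bool" where
  "equivalent LL K K' \<longleftrightarrow> models LL K = models LL K'"

(* Operators and assignments are total HOL functions of which only the values on
   belief bases matter. *)
definition base_change_operator ::
  "('s, 'w) base_logic \<Rightarrow> ('s set \<Rightarrow> 's set \<Rightarrow> 's set) \<Rightarrow> bool" where
  "base_change_operator LL opr \<longleftrightarrow>
     (\<forall>K \<Gamma>. belief_base LL K \<longrightarrow> belief_base LL \<Gamma> \<longrightarrow> belief_base LL (opr K \<Gamma>))"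

definition G1 :: "('s, 'w) base_logic \<Rightarrow> ('s set \<Rightarrow> 's set \<Rightarrow> 's set) \<Rightarrow> bool" where
  "G1 LL opr \<longleftrightarrow>
     (\<forall>K \<Gamma>. belief_base LL K \<longrightarrow> belief_base LL \<Gamma> \<longrightarrow> entails LL (opr K \<Gamma>) \<Gamma>)"

definition G2 :: "('s, 'w) base_logic \<Rightarrow> ('s set \<Rightarrow> 's set \<Rightarrow> 's set) \<Rightarrow> bool" where
  "G2 LL opr \<longleftrightarrow>
     (\<forall>K \<Gamma>. belief_base LL K \<longrightarrow> belief_base LL \<Gamma> \<longrightarrow>
        models LL (K \<union> \<Gamma>) \<noteq> {} \<longrightarrow> equivalent LL (opr K \<Gamma>) (K \<union> \<Gamma>))"

definition G3 :: "('s, 'w) base_logic \<Rightarrow> ('s set \<Rightarrow> 's set \<Rightarrow> 's set) \<Rightarrow> bool" where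
  "G3 LL opr \<longleftrightarrow>
     (\<forall>K \<Gamma>. belief_base LL K \<longrightarrow> belief_base LL \<Gamma> \<longrightarrow>
        models LL \<Gamma> \<noteq> {} \<longrightarrow> models LL (opr K \<Gamma>) \<noteq> {})"

definition G4 :: "('s, 'w) base_logic \<Rightarrow> ('s set \<Rightarrow> 's set \<Rightarrow> 's set) \<Rightarrow> bool" where
  "G4 LL opr \<longleftrightarrow>
     (\<forall>K1 K2 \<Gamma>1 \<Gamma>2. belief_base LL K1 \<longrightarrow> belief_base LL K2 \<longrightarrow>
        belief_base LL \<Gamma>1 \<longrightarrow> belief_base LL \<Gamma>2 \<longrightarrow>
        equivalent LL K1 K2 \<longrightarrow> equivalent LL \<Gamma>1 \<Gamma>2 \<longrightarrow>
        equivalent LL (opr K1 \<Gamma>1) (opr K2 \<Gamma>2))"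

definition G5 :: "('s, 'w) base_logic \<Rightarrow> ('s set \<Rightarrow> 's set \<Rightarrow> 's set) \<Rightarrow> bool" where
  "G5 LL opr \<longleftrightarrow>
     (\<forall>K \<Gamma>1 \<Gamma>2. belief_base LL K \<longrightarrow> belief_base LL \<Gamma>1 \<longrightarrow> belief_base LL \<Gamma>2 \<longrightarrow>
        entails LL (opr K \<Gamma>1 \<union> \<Gamma>2) (opr K (\<Gamma>1 \<union> \<Gamma>2)))"

definition G6 :: "('s, 'w) base_logic \<Rightarrow> ('s set \<Rightarrow> 's set \<Rightarrow> 's set) \<Rightarrow> bool" where
  "G6 LL opr \<longleftrightarrow>
     (\<forall>K \<Gamma>1 \<Gamma>2. belief_base LL K \<longrightarrow> belief_base LL \<Gamma>1 \<longrightarrow> belief_base LL \<Gamma>2 \<longrightarrow>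
        models LL (opr K \<Gamma>1 \<union> \<Gamma>2) \<noteq> {} \<longrightarrow>
        entails LL (opr K (\<Gamma>1 \<union> \<Gamma>2)) (opr K \<Gamma>1 \<union> \<Gamma>2))"

(* Unlike total_on, this includes reflexivity on A. *)
definition total_rel_on :: "'w set \<Rightarrow> 'w rel \<Rightarrow> bool" where
  "total_rel_on A r \<longleftrightarrow>
     r \<subseteq> A \<times> A \<and> (\<forall>\<omega>1\<in>A. \<forall>\<omega>2\<in>A. (\<omega>1, \<omega>2) \<in> r \<or> (\<omega>2, \<omega>1) \<in> r)"

definition strictly :: "'w rel \<Rightarrow> 'w \<Rightarrow> 'w \<Rightarrow> bool" where
  "strictly r \<omega>1 \<omega>2 \<longleftrightarrow> (\<omega>1, \<omega>2) \<in> r \<and> (\<omega>2, \<omega>1) \<notin> r"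

(* Least elements; r is not assumed to be transitive. *)
definition min_set :: "'w set \<Rightarrow> 'w rel \<Rightarrow> 'w set" where
  "min_set A r = {\<omega> \<in> A. \<forall>\<omega>'\<in>A. (\<omega>, \<omega>') \<in> r}"

definition min_retractive :: "('s, 'w) base_logic \<Rightarrow> 'w rel \<Rightarrow> bool" where
  "min_retractive LL r \<longleftrightarrow>
     (\<forall>\<Gamma>. belief_base LL \<Gamma> \<longrightarrow>
        (\<forall>\<omega>\<in>models LL \<Gamma>. \<forall>\<omega>'\<in>models LL \<Gamma>.
           (\<omega>', \<omega>) \<in> r \<longrightarrow> \<omega> \<in> min_set (models LL \<Gamma>) r \<longrightarrow>
           \<omega>' \<in> min_set (models LL \<Gamma>) r))"

definition min_complete :: "('s, 'w) base_logic \<Rightarrow> 'w rel \<Rightarrow> bool" where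
  "min_complete LL r \<longleftrightarrow>
     (\<forall>\<Gamma>. belief_base LL \<Gamma> \<longrightarrow> models LL \<Gamma> \<noteq> {} \<longrightarrow> min_set (models LL \<Gamma>) r \<noteq> {})"

definition min_friendly :: "('s, 'w) base_logic \<Rightarrow> 'w rel \<Rightarrow> bool" where
  "min_friendly LL r \<longleftrightarrow> min_retractive LL r \<and> min_complete LL r"

definition assignment :: "('s, 'w) base_logic \<Rightarrow> ('s set \<Rightarrow> 'w rel) \<Rightarrow> bool" where
  "assignment LL pre \<longleftrightarrow>
     (\<forall>K. belief_base LL K \<longrightarrow> total_rel_on (Interps LL) (pre K))"

definition min_friendly_assignment ::
  "('s, 'w) base_logic \<Rightarrow> ('s set \<Rightarrow> 'w rel) \<Rightarrow> bool" where
  "min_friendly_assignment LL pre \<longleftrightarrow>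
     assignment LL pre \<and> (\<forall>K. belief_base LL K \<longrightarrow> min_friendly LL (pre K))"

definition F1 :: "('s, 'w) base_logic \<Rightarrow> ('s set \<Rightarrow> 'w rel) \<Rightarrow> bool" where
  "F1 LL pre \<longleftrightarrow>
     (\<forall>K. belief_base LL K \<longrightarrow>
        (\<forall>\<omega>\<in>Interps LL. \<forall>\<omega>'\<in>Interps LL.
           \<omega> \<in> models LL K \<longrightarrow> \<omega>' \<in> models LL K \<longrightarrow> \<not> strictly (pre K) \<omega> \<omega>'))"

definition F2 :: "('s, 'w) base_logic \<Rightarrow> ('s set \<Rightarrow> 'w rel) \<Rightarrow> bool" where
  "F2 LL pre \<longleftrightarrow>
     (\<forall>K. belief_base LL K \<longrightarrow>
        (\<forall>\<omega>\<in>Interps LL. \<forall>\<omega>'\<in>Interps LL.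
           \<omega> \<in> models LL K \<longrightarrow> \<omega>' \<notin> models LL K \<longrightarrow> strictly (pre K) \<omega> \<omega>'))"

definition F3 :: "('s, 'w) base_logic \<Rightarrow> ('s set \<Rightarrow> 'w rel) \<Rightarrow> bool" where
  "F3 LL pre \<longleftrightarrow>
     (\<forall>K K'. belief_base LL K \<longrightarrow> belief_base LL K' \<longrightarrow>
        equivalent LL K K' \<longrightarrow> pre K = pre K')"

definition faithful_assignment ::
  "('s, 'w) base_logic \<Rightarrow> ('s set \<Rightarrow> 'w rel) \<Rightarrow> bool" where
  "faithful_assignment LL pre \<longleftrightarrow>
     assignment LL pre \<and> F1 LL pre \<and> F2 LL pre \<and> F3 LL pre"

definition compatible ::
  "('s, 'w) base_logic \<Rightarrow> ('s set \<Rightarrow> 's set \<Rightarrow> 's set) \<Rightarrow> ('s set \<Rightarrow> 'w rel) \<Rightarrow> bool" where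
  "compatible LL opr pre \<longleftrightarrow>
     (\<forall>K \<Gamma>. belief_base LL K \<longrightarrow> belief_base LL \<Gamma> \<longrightarrow>
        models LL (opr K \<Gamma>) = min_set (models LL \<Gamma>) (pre K))"

end

theory Submission
  imports Defs
begin

text \<open>
  From an operator one reads off the relation \<open>\<omega>1 \<preceq>\<^sub>K \<omega>2\<close>: whenever a base \<open>\<Gamma>\<close> holds in both
  interpretations and the revision of \<open>K\<close> by \<open>\<Gamma>\<close> admits \<open>\<omega>2\<close>, it also admits \<open>\<omega>1\<close>. Two bases
  \<open>\<Gamma>1\<close> and \<open>\<Gamma>2\<close> are compared through their union: by (G5) and (G6), if \<open>K \<circ> \<Gamma>1\<close> is consistent
  with \<open>\<Gamma>2\<close> and \<open>K \<circ> \<Gamma>2\<close> is consistent with \<open>\<Gamma>1\<close>, then the models of \<open>K \<circ> \<Gamma>1\<close> satisfying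
  \<open>\<Gamma>2\<close> coincide with the models of \<open>K \<circ> \<Gamma>2\<close> satisfying \<open>\<Gamma>1\<close>. Totality and compatibility both
  follow from this exchange; transitivity is neither available nor needed. In the converse
  direction, min-retractivity replaces transitivity in the proof of (G6).
\<close>

text \<open>All bases serve as tests because no base need have exactly \<omega>1 and \<omega>2 as
  its models, so a single test for the pair may not exist.\<close>

definition revision_order ::
  "('s, 'w) base_logic \<Rightarrow> ('s set \<Rightarrow> 's set \<Rightarrow> 's set) \<Rightarrow> 's set \<Rightarrow> 'w rel" where
  "revision_order LL opr K =
     {(\<omega>1, \<omega>2) \<in> Interps LL \<times> Interps LL.
        \<forall>\<Gamma>. belief_base LL \<Gamma> \<longrightarrow> \<omega>1 \<in> models LL \<Gamma> \<longrightarrow> \<omega>2 \<in> models LL \<Gamma> \<longrightarrow>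
          \<omega>2 \<in> models LL (opr K \<Gamma>) \<longrightarrow> \<omega>1 \<in> models LL (opr K \<Gamma>)}"

lemma models_Un: "models LL (A \<union> B) = models LL A \<inter> models LL B"
  by (auto simp: models_def)

lemma models_empty: "models LL {} = Interps LL"
  by (simp add: models_def)

lemma models_imp_Interps: "\<omega> \<in> models LL K \<Longrightarrow> \<omega> \<in> Interps LL"
  by (auto simp: models_def)

lemma belief_base_empty: "belief_base LL {}"
  by (simp add: belief_base_def)

lemma belief_base_Un:
  "belief_base LL A \<Longrightarrow> belief_base LL B \<Longrightarrow> belief_base LL (A \<union> B)"
  by (auto simp: belief_base_def)

lemma models_revision_Un:
  assumes "G5 LL opr" "G6 LL opr"
    and "belief_base LL K" "belief_base LL \<Gamma>1" "belief_base LL \<Gamma>2"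
    and "models LL (opr K \<Gamma>1) \<inter> models LL \<Gamma>2 \<noteq> {}"
  shows "models LL (opr K (\<Gamma>1 \<union> \<Gamma>2)) = models LL (opr K \<Gamma>1) \<inter> models LL \<Gamma>2"
proof (rule equalityI)
  show "models LL (opr K (\<Gamma>1 \<union> \<Gamma>2)) \<subseteq> models LL (opr K \<Gamma>1) \<inter> models LL \<Gamma>2"
    using assms by (simp add: G6_def entails_def models_Un)
  show "models LL (opr K \<Gamma>1) \<inter> models LL \<Gamma>2 \<subseteq> models LL (opr K (\<Gamma>1 \<union> \<Gamma>2))"
    using assms by (simp add: G5_def entails_def models_Un)
qed

text \<open>Both sides are the models of \<open>opr K (\<Gamma>1 \<union> \<Gamma>2)\<close>; each
  consistency hypothesis licenses (G6) for one order of the union.\<close>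

lemma revision_exchange:
  assumes "G5 LL opr" "G6 LL opr"
    and "belief_base LL K" "belief_base LL \<Gamma>1" "belief_base LL \<Gamma>2"
    and "models LL (opr K \<Gamma>1) \<inter> models LL \<Gamma>2 \<noteq> {}"
    and "models LL (opr K \<Gamma>2) \<inter> models LL \<Gamma>1 \<noteq> {}"
  shows "models LL (opr K \<Gamma>1) \<inter> models LL \<Gamma>2 = models LL (opr K \<Gamma>2) \<inter> models LL \<Gamma>1"
  using models_revision_Un[of LL opr K \<Gamma>1 \<Gamma>2] models_revision_Un[of LL opr K \<Gamma>2 \<Gamma>1] assms
  by (simp add: Un_commute)

lemma models_revision_consistent:
  assumes "G2 LL opr" "belief_base LL K" "belief_base LL \<Gamma>"
    and "\<omega> \<in> models LL K" "\<omega> \<in> models LL \<Gamma>"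
  shows "models LL (opr K \<Gamma>) = models LL K \<inter> models LL \<Gamma>"
  using assms unfolding G2_def equivalent_def models_Un by blast

lemma total_rel_on_revision_order:
  assumes "G5 LL opr" "G6 LL opr" "belief_base LL K"
  shows "total_rel_on (Interps LL) (revision_order LL opr K)"
  unfolding total_rel_on_def
proof (intro conjI ballI)
  show "revision_order LL opr K \<subseteq> Interps LL \<times> Interps LL"
    by (auto simp: revision_order_def)
next
  fix \<omega>1 \<omega>2
  assume I: "\<omega>1 \<in> Interps LL" "\<omega>2 \<in> Interps LL"
  show "(\<omega>1, \<omega>2) \<in> revision_order LL opr K \<or> (\<omega>2, \<omega>1) \<in> revision_order LL opr K"
  proof (rule ccontr)
    assume "\<not> ?thesis"
    with I obtain \<Gamma>1 \<Gamma>2 where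
      1: "belief_base LL \<Gamma>1" "\<omega>1 \<in> models LL \<Gamma>1" "\<omega>2 \<in> models LL \<Gamma>1"
        "\<omega>2 \<in> models LL (opr K \<Gamma>1)" "\<omega>1 \<notin> models LL (opr K \<Gamma>1)" and
      2: "belief_base LL \<Gamma>2" "\<omega>1 \<in> models LL \<Gamma>2" "\<omega>2 \<in> models LL \<Gamma>2"
        "\<omega>1 \<in> models LL (opr K \<Gamma>2)" "\<omega>2 \<notin> models LL (opr K \<Gamma>2)"
      unfolding revision_order_def by blast
    \<comment> \<open>\<omega>2 makes the first intersection of the exchange nonempty and \<omega>1
      the second; their equality would put \<omega>2 into the revision by \<Gamma>2.\<close>
    then show False
      using revision_exchange[OF assms, of \<Gamma>1 \<Gamma>2] by blast
  qed
qed

text \<open>The defining implication needs both interpretations to satisfy \<Gamma>; for \<omega>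
  this comes from (G1).\<close>

lemma revision_orderD:
  assumes "G1 LL opr" "belief_base LL K" "belief_base LL \<Gamma>"
    and "(\<omega>', \<omega>) \<in> revision_order LL opr K"
    and "\<omega>' \<in> models LL \<Gamma>" "\<omega> \<in> models LL (opr K \<Gamma>)"
  shows "\<omega>' \<in> models LL (opr K \<Gamma>)"
  using assms unfolding revision_order_def G1_def entails_def by blast

lemma models_revision_eq_min_set:
  assumes G: "G1 LL opr" "G3 LL opr" "G5 LL opr" "G6 LL opr"
    and K: "belief_base LL K" and B: "belief_base LL \<Gamma>"
  shows "models LL (opr K \<Gamma>) = min_set (models LL \<Gamma>) (revision_order LL opr K)"
proof (intro set_eqI iffI)
  fix \<omega> assume w: "\<omega> \<in> models LL (opr K \<Gamma>)"
  then have m: "\<omega> \<in> models LL \<Gamma>"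
    using G(1) K B unfolding G1_def entails_def by blast
  have "(\<omega>, \<omega>') \<in> revision_order LL opr K" if w': "\<omega>' \<in> models LL \<Gamma>" for \<omega>'
  proof -
    have "\<omega> \<in> models LL (opr K \<Gamma>')"
      if "belief_base LL \<Gamma>'" "\<omega> \<in> models LL \<Gamma>'" "\<omega>' \<in> models LL (opr K \<Gamma>')" for \<Gamma>'
      \<comment> \<open>\<omega> witnesses that the revision by \<Gamma> is consistent with
        \<Gamma>', and \<omega>' the symmetric fact; the exchange carries \<omega> over.\<close>
      using revision_exchange[OF G(3,4) K B that(1)] w m w' that(2,3) by blast
    with m w' show ?thesis
      by (simp add: revision_order_def models_imp_Interps)
  qed
  with m show "\<omega> \<in> min_set (models LL \<Gamma>) (revision_order LL opr K)"
    by (simp add: min_set_def)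
next
  fix \<omega> assume w: "\<omega> \<in> min_set (models LL \<Gamma>) (revision_order LL opr K)"
  then have m: "\<omega> \<in> models LL \<Gamma>" by (simp add: min_set_def)
  then obtain \<omega>' where w': "\<omega>' \<in> models LL (opr K \<Gamma>)"
    using G(2) K B unfolding G3_def by blast
  then have "\<omega>' \<in> models LL \<Gamma>"
    using G(1) K B unfolding G1_def entails_def by blast
  with w have "(\<omega>, \<omega>') \<in> revision_order LL opr K" by (simp add: min_set_def)
  then show "\<omega> \<in> models LL (opr K \<Gamma>)"
    using revision_orderD[OF G(1) K B _ m w'] by blast
qed

text \<open>With minima identified as models of the revision, retractivity is
  \<open>revision_orderD\<close> and completeness is (G3).\<close>

lemma min_friendly_revision_order:
  assumes G: "G1 LL opr" "G3 LL opr" "G5 LL opr" "G6 LL opr" and K: "belief_base LL K"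
  shows "min_friendly LL (revision_order LL opr K)"
  unfolding min_friendly_def min_retractive_def min_complete_def
proof (intro conjI allI ballI impI)
  fix \<Gamma> \<omega> \<omega>'
  assume "belief_base LL \<Gamma>" "\<omega>' \<in> models LL \<Gamma>" "(\<omega>', \<omega>) \<in> revision_order LL opr K"
    and "\<omega> \<in> min_set (models LL \<Gamma>) (revision_order LL opr K)"
  then show "\<omega>' \<in> min_set (models LL \<Gamma>) (revision_order LL opr K)"
    using revision_orderD[OF G(1) K] models_revision_eq_min_set[OF G K] by metis
next
  fix \<Gamma>
  assume "belief_base LL \<Gamma>" "models LL \<Gamma> \<noteq> {}"
  then show "min_set (models LL \<Gamma>) (revision_order LL opr K) \<noteq> {}"
    using models_revision_eq_min_set[OF G K] G(2) K unfolding G3_def by metis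
qed

text \<open>Any base satisfied by \<omega> is consistent with \<open>K\<close>, so by (G2) the
  revision keeps \<omega>. This yields (F1) and the positive half of (F2).\<close>

lemma revision_order_model:
  assumes "G2 LL opr" "belief_base LL K" "\<omega> \<in> models LL K" "\<omega>' \<in> Interps LL"
  shows "(\<omega>, \<omega>') \<in> revision_order LL opr K"
  using assms models_revision_consistent[OF assms(1,2) _ assms(3)]
  by (simp add: revision_order_def models_imp_Interps)

lemma not_revision_order_nonmodel:
  assumes "G2 LL opr" "belief_base LL K" "\<omega> \<in> models LL K"
    and "\<omega>' \<in> Interps LL" "\<omega>' \<notin> models LL K"
  shows "(\<omega>', \<omega>) \<notin> revision_order LL opr K"
proof -
  have i: "\<omega> \<in> Interps LL" using assms(3) by (rule models_imp_Interps)
  \<comment> \<open>The empty base separates the two: every interpretation satisfies it, and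
    revising by it leaves just the models of \<open>K\<close>.\<close>
  then have "models LL (opr K {}) = models LL K \<inter> Interps LL"
    using models_revision_consistent[OF assms(1,2) belief_base_empty assms(3)]
    by (simp add: models_empty)
  with assms i have "\<omega>' \<in> models LL {}" "\<omega> \<in> models LL {}"
    "\<omega> \<in> models LL (opr K {})" "\<omega>' \<notin> models LL (opr K {})"
    by (auto simp: models_empty)
  then show ?thesis
    using belief_base_empty[of LL] unfolding revision_order_def by blast
qed

text \<open>The relation depends on \<open>K\<close> only through the models of its revisions, which
  (G4) fixes up to equivalence.\<close>

lemma F3_revision_order:
  assumes "G4 LL opr"
  shows "F3 LL (revision_order LL opr)"
  unfolding F3_def
proof (intro allI impI)
  fix K K'
  assume "belief_base LL K" "belief_base LL K'" "equivalent LL K K'"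
  then have "models LL (opr K \<Gamma>) = models LL (opr K' \<Gamma>)" if "belief_base LL \<Gamma>" for \<Gamma>
    using assms that unfolding G4_def equivalent_def by blast
  then show "revision_order LL opr K = revision_order LL opr K'"
    unfolding revision_order_def by blast
qed

lemma faithful_revision_order:
  assumes "G2 LL opr" "G4 LL opr" "G5 LL opr" "G6 LL opr"
  shows "faithful_assignment LL (revision_order LL opr)"
  unfolding faithful_assignment_def assignment_def F1_def F2_def strictly_def
  using assms by (auto simp: total_rel_on_revision_order revision_order_model
      not_revision_order_nonmodel F3_revision_order)

lemma min_set_faithful:
  assumes F: "faithful_assignment LL pre" and K: "belief_base LL K"
    and w0: "\<omega>0 \<in> models LL K" "\<omega>0 \<in> models LL \<Gamma>"
  shows "min_set (models LL \<Gamma>) (pre K) = models LL K \<inter> models LL \<Gamma>"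
proof (intro set_eqI iffI)
  fix \<omega> assume w: "\<omega> \<in> min_set (models LL \<Gamma>) (pre K)"
  then have m: "\<omega> \<in> models LL \<Gamma>" and le: "(\<omega>, \<omega>0) \<in> pre K"
    using w0 by (auto simp: min_set_def)
  moreover have "\<omega> \<in> Interps LL" "\<omega>0 \<in> Interps LL"
    using m w0 by (auto intro: models_imp_Interps)
  \<comment> \<open>Were \<omega> not a model of \<open>K\<close>, (F2) would place \<omega>0
    strictly below it, against \<open>le\<close>.\<close>
  ultimately show "\<omega> \<in> models LL K \<inter> models LL \<Gamma>"
    using F K w0 unfolding faithful_assignment_def F2_def strictly_def by blast
next
  fix \<omega> assume w: "\<omega> \<in> models LL K \<inter> models LL \<Gamma>"
  have "(\<omega>, \<omega>') \<in> pre K" if "\<omega>' \<in> models LL \<Gamma>" for \<omega>'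
  proof -
    have I: "\<omega> \<in> Interps LL" "\<omega>' \<in> Interps LL"
      using w that by (auto intro: models_imp_Interps)
    show ?thesis
    proof (cases "\<omega>' \<in> models LL K")
      case True
      \<comment> \<open>Between models of \<open>K\<close>, (F1) excludes the strict relation, and
        totality turns this into \<omega> being below \<omega>'.\<close>
      then have "\<not> strictly (pre K) \<omega>' \<omega>"
        using F K I w unfolding faithful_assignment_def F1_def by blast
      then show ?thesis
        using F K I unfolding faithful_assignment_def assignment_def total_rel_on_def strictly_def
        by blast
    next
      case False
      then show ?thesis
        using F K I w unfolding faithful_assignment_def F2_def strictly_def by blast
    qed
  qed
  with w show "\<omega> \<in> min_set (models LL \<Gamma>) (pre K)" by (simp add: min_set_def)
qed

lemma compatible_imp_postulates:
  assumes M: "min_friendly_assignment LL pre" and F: "faithful_assignment LL pre"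
    and C: "compatible LL opr pre"
  shows "G1 LL opr" "G2 LL opr" "G3 LL opr" "G4 LL opr" "G5 LL opr" "G6 LL opr"
proof -
  have c: "models LL (opr K \<Gamma>) = min_set (models LL \<Gamma>) (pre K)"
    if "belief_base LL K" "belief_base LL \<Gamma>" for K \<Gamma>
    using C that by (simp add: compatible_def)
  show "G1 LL opr"
    by (auto simp: G1_def entails_def c min_set_def)
  show "G2 LL opr"
    unfolding G2_def equivalent_def models_Un
    using c min_set_faithful[OF F] by blast
  show "G3 LL opr"
    using M by (simp add: G3_def c min_friendly_assignment_def min_friendly_def min_complete_def)
  show "G4 LL opr"
    unfolding G4_def equivalent_def
  proof (intro allI impI)
    fix K1 K2 \<Gamma>1 \<Gamma>2
    assume b: "belief_base LL K1" "belief_base LL K2" "belief_base LL \<Gamma>1" "belief_base LL \<Gamma>2"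
      and e: "models LL K1 = models LL K2" "models LL \<Gamma>1 = models LL \<Gamma>2"
    have "pre K1 = pre K2"
      using F b e unfolding faithful_assignment_def F3_def equivalent_def by blast
    with b e show "models LL (opr K1 \<Gamma>1) = models LL (opr K2 \<Gamma>2)" by (simp add: c)
  qed
  \<comment> \<open>A least element of a set remains least in any subset containing it.\<close>
  show "G5 LL opr"
    by (auto simp: G5_def entails_def c models_Un belief_base_Un min_set_def)
  show "G6 LL opr"
    unfolding G6_def entails_def models_Un
  proof (intro allI impI subsetI)
    fix K \<Gamma>1 \<Gamma>2 \<omega>
    assume b: "belief_base LL K" "belief_base LL \<Gamma>1" "belief_base LL \<Gamma>2"
      and ne: "models LL (opr K \<Gamma>1) \<inter> models LL \<Gamma>2 \<noteq> {}"
      and w: "\<omega> \<in> models LL (opr K (\<Gamma>1 \<union> \<Gamma>2))"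
    from ne obtain \<omega>0 where w0: "\<omega>0 \<in> min_set (models LL \<Gamma>1) (pre K)" "\<omega>0 \<in> models LL \<Gamma>2"
      using c b by auto
    have m: "\<omega> \<in> models LL \<Gamma>1" "\<omega> \<in> models LL \<Gamma>2" "(\<omega>, \<omega>0) \<in> pre K" "\<omega>0 \<in> models LL \<Gamma>1"
      using w w0 b by (auto simp: c belief_base_Un models_Un min_set_def)
    \<comment> \<open>\<omega> is below \<omega>0, which is least among the models of \<Gamma>1;
      retractivity passes this minimality on to \<omega>.\<close>
    moreover have "min_retractive LL (pre K)"
      using M b by (simp add: min_friendly_assignment_def min_friendly_def)
    ultimately have "\<omega> \<in> min_set (models LL \<Gamma>1) (pre K)"
      using w0 b unfolding min_retractive_def by blast
    with m b show "\<omega> \<in> models LL (opr K \<Gamma>1) \<inter> models LL \<Gamma>2" by (simp add: c)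
  qed
qed

theorem theorem2:
  fixes LL :: "('s, 'w) base_logic"
    and opr :: "'s set \<Rightarrow> 's set \<Rightarrow> 's set"
  assumes "base_change_operator LL opr"
  shows "(G1 LL opr \<and> G2 LL opr \<and> G3 LL opr \<and> G4 LL opr \<and> G5 LL opr \<and> G6 LL opr) \<longleftrightarrow>
    (\<exists>pre :: 's set \<Rightarrow> 'w rel.
       min_friendly_assignment LL pre \<and> faithful_assignment LL pre \<and> compatible LL opr pre)"
proof
  assume G: "G1 LL opr \<and> G2 LL opr \<and> G3 LL opr \<and> G4 LL opr \<and> G5 LL opr \<and> G6 LL opr"
  then have "faithful_assignment LL (revision_order LL opr)"
    by (simp add: faithful_revision_order)
  moreover from this have "min_friendly_assignment LL (revision_order LL opr)"
    using G by (simp add: min_friendly_assignment_def faithful_assignment_def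
        min_friendly_revision_order)
  moreover have "compatible LL opr (revision_order LL opr)"
    using G by (simp add: compatible_def models_revision_eq_min_set)
  ultimately show "\<exists>pre :: 's set \<Rightarrow> 'w rel.
      min_friendly_assignment LL pre \<and> faithful_assignment LL pre \<and> compatible LL opr pre"
    by (intro exI conjI)
next
  assume "\<exists>pre :: 's set \<Rightarrow> 'w rel.
      min_friendly_assignment LL pre \<and> faithful_assignment LL pre \<and> compatible LL opr pre"
  then show "G1 LL opr \<and> G2 LL opr \<and> G3 LL opr \<and> G4 LL opr \<and> G5 LL opr \<and> G6 LL opr"
    by (elim exE conjE) (intro conjI; rule compatible_imp_postulates)
qed

end
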